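(* Let $\tau\in I_n$ be an involution and let $\Phi(\tau)=(M,\lambda)$. Then $\tau$ avoids the pattern $4321$ if and only if $\lambda$ is the unitary labelling, i.e. $\lambda(D)=1$ for every down step $D$ of $M$.
   Context: $I_n$ is the set of involutions in the symmetric group $S_n$. A permutation $\sigma\in S_n$ contains the pattern $\pi\in S_k$ if there are $1\le i_1<\dots<i_k\le n$ such that $(\sigma(i_1),\dots,\sigma(i_k))$ is order-isomorphic to $\pi$; otherwise $\sigma$ avoids $\pi$. A Motzkin path of length $n$ is a lattice path from $(0,0)$ to $(n,0)$ never going below the $x$-axis, with up steps $U=(1,1)$, horizontal steps $H=(1,0)$ and down steps $D=(1,-1)$. The height of a step is the larger $y$-coordinate of the step. A labelling of a Motzkin path $M$ is a map $\lambda$ assigning to every down step $D$ at height $h$ an integer $\lambda(D)$ with $1\le\lambda(D)\le h$; the pair $(M,\lambda)$ is a labelled Motzkin path. The unitary labelling $\upsilon$ assigns $1$ to every down step. The bijection $\Phi$ from $I_n$ to the set of labelled Motzkin paths of length $n$: given $\tau\in I_n$, start with the empty path and the list $A_\tau$ of the elements of $\{i:\tau(i)>i\}$ in increasing order. For $i=1,\dots,n$ in order: if $\tau(i)=i$, the $i$-th step is $H$; if $\tau(i)>i$, the $i$-th step is $U$; if $\tau(i)<i$, the $i$-th step is $D$, it is given as label the position $k$ of $\tau(i)$ in the current list $A_\tau$, and then $\tau(i)$ is removed from $A_\tau$. The result is $\Phi(\tau)$. *)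

theory Defs
  imports "HOL-Combinatorics.Permutations"
begin

definition involutions :: "nat \<Rightarrow> (nat \<Rightarrow> nat) set" where
  "involutions n = {\<tau>. \<tau> permutes {1..n} \<and> \<tau> \<circ> \<tau> = id}"

definition order_isomorphic :: "nat list \<Rightarrow> nat list \<Rightarrow> bool" where
  "order_isomorphic xs ys \<longleftrightarrow> length xs = length ys \<and>
     (\<forall>a<length xs. \<forall>b<length xs. xs ! a < xs ! b \<longleftrightarrow> ys ! a < ys ! b)"

text \<open>The pattern is given in one-line notation, as the list of its values.\<close>

definition contains_pattern :: "nat \<Rightarrow> (nat \<Rightarrow> nat) \<Rightarrow> nat list \<Rightarrow> bool" where
  "contains_pattern n \<sigma> \<pi> \<longleftrightarrow>
     (\<exists>is. sorted_wrt (<) is \<and> set is \<subseteq> {1..n} \<and> order_isomorphic (map \<sigma> is) \<pi>)"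

definition avoids_pattern :: "nat \<Rightarrow> (nat \<Rightarrow> nat) \<Rightarrow> nat list \<Rightarrow> bool" where
  "avoids_pattern n \<sigma> \<pi> \<longleftrightarrow> \<not> contains_pattern n \<sigma> \<pi>"

datatype step = U | H | D

primrec rise :: "step \<Rightarrow> int" where
  "rise U = 1"
| "rise H = 0"
| "rise D = - 1"

definition altitude :: "step list \<Rightarrow> nat \<Rightarrow> int" where
  "altitude M k = (\<Sum>s\<leftarrow>take k M. rise s)"

definition motzkin_path :: "nat \<Rightarrow> step list \<Rightarrow> bool" where
  "motzkin_path n M \<longleftrightarrow> length M = n \<and> (\<forall>k\<le>n. 0 \<le> altitude M k) \<and> altitude M n = 0"

text \<open>Steps are numbered from 1, so the step numbered \<open>j\<close> is \<open>M ! (j - 1)\<close>.\<close>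

definition step_height :: "step list \<Rightarrow> nat \<Rightarrow> int" where
  "step_height M j = max (altitude M (j - 1)) (altitude M j)"

definition down_steps :: "step list \<Rightarrow> nat set" where
  "down_steps M = {j \<in> {1..length M}. M ! (j - 1) = D}"

text \<open>A labelling is a partial map defined exactly on the numbers of the down steps.\<close>

definition labelling :: "step list \<Rightarrow> (nat \<rightharpoonup> nat) \<Rightarrow> bool" where
  "labelling M \<Lambda> \<longleftrightarrow> dom \<Lambda> = down_steps M \<and>
     (\<forall>j\<in>down_steps M. 1 \<le> the (\<Lambda> j) \<and> int (the (\<Lambda> j)) \<le> step_height M j)"

definition labelled_motzkin_paths :: "nat \<Rightarrow> (step list \<times> (nat \<rightharpoonup> nat)) set" where
  "labelled_motzkin_paths n = {(M, \<Lambda>). motzkin_path n M \<and> labelling M \<Lambda>}"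

definition unitary_labelling :: "step list \<Rightarrow> (nat \<rightharpoonup> nat)" where
  "unitary_labelling M = (\<lambda>j. if j \<in> down_steps M then Some 1 else None)"

text \<open>The position, counted from 1, of the first occurrence of \<open>x\<close> in \<open>xs\<close>.\<close>

definition position :: "'a \<Rightarrow> 'a list \<Rightarrow> nat" where
  "position x xs = Suc (length (takeWhile (\<lambda>y. y \<noteq> x) xs))"

definition Phi_step :: "(nat \<Rightarrow> nat) \<Rightarrow> nat \<Rightarrow>
    step list \<times> (nat \<rightharpoonup> nat) \<times> nat list \<Rightarrow> step list \<times> (nat \<rightharpoonup> nat) \<times> nat list" where
  "Phi_step \<tau> i = (\<lambda>(M, \<Lambda>, A).
     if \<tau> i = i then (M @ [H], \<Lambda>, A)
     else if \<tau> i > i then (M @ [U], \<Lambda>, A)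
     else (M @ [D], \<Lambda>(i \<mapsto> position (\<tau> i) A), remove1 (\<tau> i) A))"

definition Phi :: "nat \<Rightarrow> (nat \<Rightarrow> nat) \<Rightarrow> step list \<times> (nat \<rightharpoonup> nat)" where
  "Phi n \<tau> = (let (M, \<Lambda>, A) = fold (Phi_step \<tau>) [1..<Suc n]
       ([], Map.empty, sorted_list_of_set {i \<in> {1..n}. \<tau> i > i}) in (M, \<Lambda>))"


subsection \<open>The map takes involutions to labelled Motzkin paths\<close>

definition openers :: "nat \<Rightarrow> (nat \<Rightarrow> nat) \<Rightarrow> nat \<Rightarrow> nat set" where
  "openers n \<tau> m = {i \<in> {1..n}. \<tau> i > i \<and> \<tau> i > m}"

definition step_of :: "(nat \<Rightarrow> nat) \<Rightarrow> nat \<Rightarrow> step" where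
  "step_of \<tau> i = (if \<tau> i = i then H else if \<tau> i > i then U else D)"

lemma involutionsD:
  assumes "\<tau> \<in> involutions n"
  shows "\<tau> (\<tau> i) = i" and "i \<in> {1..n} \<Longrightarrow> \<tau> i \<in> {1..n}" and "\<tau> i = \<tau> j \<longleftrightarrow> i = j"
proof -
  have "\<tau> permutes {1..n}" and inv: "\<tau> \<circ> \<tau> = id"
    using assms by (auto simp: involutions_def)
  then show "i \<in> {1..n} \<Longrightarrow> \<tau> i \<in> {1..n}" by (metis permutes_in_image)
  show *: "\<tau> (\<tau> i) = i" for i using inv by (metis comp_apply id_apply)
  show "\<tau> i = \<tau> j \<longleftrightarrow> i = j" by (metis *)
qed

lemma Phi_fold:
  assumes "\<tau> \<in> involutions n" "m \<le> n"
  shows "fold (Phi_step \<tau>) [1..<Suc m]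
      ([], Map.empty, sorted_list_of_set {i \<in> {1..n}. \<tau> i > i}) =
    (map (step_of \<tau>) [1..<Suc m],
     (\<lambda>j. if j \<in> {1..m} \<and> \<tau> j < j
          then Some (position (\<tau> j) (sorted_list_of_set (openers n \<tau> (j - 1)))) else None),
     sorted_list_of_set (openers n \<tau> m))"
  using assms(2)
proof (induction m)
  case 0
  have "openers n \<tau> 0 = {i \<in> {1..n}. \<tau> i > i}" by (auto simp: openers_def)
  then show ?case by (simp add: fun_eq_iff)
next
  case (Suc m)
  note inv = involutionsD[OF assms(1)]
  have fin: "finite (openers n \<tau> m)" by (simp add: openers_def)
  have open_eq: "openers n \<tau> (Suc m) =
      (if \<tau> (Suc m) < Suc m then openers n \<tau> m - {\<tau> (Suc m)} else openers n \<tau> m)"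
  proof (rule set_eqI)
    fix i
    show "i \<in> openers n \<tau> (Suc m) \<longleftrightarrow> i \<in> (if \<tau> (Suc m) < Suc m
        then openers n \<tau> m - {\<tau> (Suc m)} else openers n \<tau> m)"
    proof (cases "\<tau> i = Suc m")
      case True
      then have "\<tau> (Suc m) = i" using inv(1) by metis
      with True show ?thesis by (auto simp: openers_def)
    next
      case False
      moreover have "i \<noteq> \<tau> (Suc m)" using False inv(1) by metis
      ultimately show ?thesis by (auto simp: openers_def)
    qed
  qed
  have upt: "[1..<Suc (Suc m)] = [1..<Suc m] @ [Suc m]" by simp
  show ?case
    unfolding upt fold_append comp_apply Suc.IH[OF Suc_leD[OF Suc.prems]]
    using fin by (auto simp: Phi_step_def open_eq step_of_def fun_eq_iff
      sorted_list_of_set.sorted_key_list_of_set_remove le_Suc_eq)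
qed

lemma Phi_eq:
  assumes "\<tau> \<in> involutions n"
  shows "Phi n \<tau> = (map (step_of \<tau>) [1..<Suc n],
     (\<lambda>j. if j \<in> {1..n} \<and> \<tau> j < j
          then Some (position (\<tau> j) (sorted_list_of_set (openers n \<tau> (j - 1)))) else None))"
  unfolding Phi_def Phi_fold[OF assms order_refl] by simp

lemma altitude_step_of:
  assumes "\<tau> \<in> involutions n" "m \<le> n"
  shows "altitude (map (step_of \<tau>) [1..<Suc n]) m = int (card {i \<in> {1..m}. \<tau> i > m})"
  using assms(2)
proof (induction m)
  case 0
  then show ?case by (simp add: altitude_def)
next
  case (Suc m)
  note inv = involutionsD[OF assms(1)]
  let ?S = "\<lambda>m. {i \<in> {1..m}. \<tau> i > m}"
  have "altitude (map (step_of \<tau>) [1..<Suc n]) (Suc m) =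
      altitude (map (step_of \<tau>) [1..<Suc n]) m + rise (step_of \<tau> (Suc m))"
    using Suc.prems by (simp add: altitude_def take_Suc_conv_app_nth del: upt_Suc)
  also have "\<dots> = int (card (?S m)) + rise (step_of \<tau> (Suc m))"
    using Suc by simp
  also have "\<dots> = int (card (?S (Suc m)))"
  proof -
    have mem: "i \<noteq> Suc m \<Longrightarrow> i \<noteq> \<tau> (Suc m) \<Longrightarrow> i \<in> ?S (Suc m) \<longleftrightarrow> i \<in> ?S m" for i
      using inv(1)[of i] by (auto simp: le_Suc_eq) (metis Suc_lessI)
    consider "\<tau> (Suc m) = Suc m" | "\<tau> (Suc m) > Suc m" | "\<tau> (Suc m) < Suc m" by linarith
    then show ?thesis
    proof cases
      case 1
      have "i \<in> ?S (Suc m) \<longleftrightarrow> i \<in> ?S m" for i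
        using mem[of i] inv(1) 1 by (cases "i = Suc m"; cases "i = \<tau> (Suc m)") auto
      then have "?S (Suc m) = ?S m" by blast
      with 1 show ?thesis by (simp add: step_of_def)
    next
      case 2
      have "i \<in> ?S (Suc m) \<longleftrightarrow> i \<in> insert (Suc m) (?S m)" for i
        using mem[of i] inv(1) 2 by (cases "i = Suc m"; cases "i = \<tau> (Suc m)") auto
      then have "?S (Suc m) = insert (Suc m) (?S m)" by blast
      with 2 show ?thesis by (simp add: step_of_def)
    next
      case 3
      have "\<tau> (Suc m) \<in> {1..n}" using inv(2) Suc.prems by simp
      with 3 have "\<tau> (Suc m) \<in> ?S m" using inv(1) by auto
      moreover have "i \<in> ?S (Suc m) \<longleftrightarrow> i \<in> ?S m - {\<tau> (Suc m)}" for i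
        using mem[of i] inv(1) 3 by (cases "i = Suc m"; cases "i = \<tau> (Suc m)") auto
      then have "?S (Suc m) = ?S m - {\<tau> (Suc m)}" by blast
      ultimately have "card (?S m) = Suc (card (?S (Suc m)))"
        using card.remove[of "?S m" "\<tau> (Suc m)"] by simp
      with 3 show ?thesis by (simp add: step_of_def)
    qed
  qed
  finally show ?case .
qed

lemma position_sorted_list_of_set:
  fixes x :: nat
  assumes "finite S" "x \<in> S"
  shows "position x (sorted_list_of_set S) = card {y \<in> S. y \<le> x}"
proof -
  obtain ys zs where eq: "sorted_list_of_set S = ys @ x # zs" and "x \<notin> set ys"
    using assms split_list_first[of x "sorted_list_of_set S"] by auto
  have sw: "sorted_wrt (<) (ys @ x # zs)"
    unfolding eq[symmetric] by (rule strict_sorted_list_of_set)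
  have S: "S = insert x (set ys \<union> set zs)"
    using arg_cong[OF eq, of set] assms by simp
  have "{y \<in> S. y \<le> x} = insert x (set ys)"
    using sw unfolding S by (auto simp: sorted_wrt_append dest: less_imp_le)
  moreover have "distinct ys"
    using eq distinct_sorted_list_of_set[of S] by simp
  ultimately have "card {y \<in> S. y \<le> x} = Suc (length ys)"
    using \<open>x \<notin> set ys\<close> by (simp add: distinct_card)
  moreover have "takeWhile (\<lambda>y. y \<noteq> x) (ys @ x # zs) = ys"
    using \<open>x \<notin> set ys\<close> by (subst takeWhile_append2) auto
  ultimately show ?thesis by (simp add: position_def eq)
qed

lemma Phi_in_labelled_motzkin_paths:
  assumes "\<tau> \<in> involutions n"
  shows "Phi n \<tau> \<in> labelled_motzkin_paths n"
proof -
  note inv = involutionsD[OF assms]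
  define M where "M = map (step_of \<tau>) [1..<Suc n]"
  define \<Lambda> where "\<Lambda> = (\<lambda>j. if j \<in> {1..n} \<and> \<tau> j < j
    then Some (position (\<tau> j) (sorted_list_of_set (openers n \<tau> (j - 1)))) else None)"
  have alt: "altitude M m = int (card {i \<in> {1..m}. \<tau> i > m})" if "m \<le> n" for m
    using altitude_step_of[OF assms that] by (simp add: M_def)
  have len: "length M = n" by (simp add: M_def)
  have "altitude M n = 0" using alt[of n] inv(2) by fastforce
  then have path: "motzkin_path n M" using len alt by (simp add: motzkin_path_def)
  have down: "down_steps M = {j \<in> {1..n}. \<tau> j < j}"
    unfolding down_steps_def len
    by (auto simp: M_def step_of_def nth_append simp del: upt_Suc split: if_splits)
  have "1 \<le> the (\<Lambda> j) \<and> int (the (\<Lambda> j)) \<le> step_height M j" if "j \<in> {1..n}" "\<tau> j < j" for j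
  proof -
    let ?S = "openers n \<tau> (j - 1)"
    have fin: "finite ?S" by (simp add: openers_def)
    have mem: "\<tau> j \<in> ?S" using that inv(1) inv(2)[of j] by (auto simp: openers_def)
    have \<Lambda>: "the (\<Lambda> j) = card {y \<in> ?S. y \<le> \<tau> j}"
      using that position_sorted_list_of_set[OF fin mem] by (simp add: \<Lambda>_def)
    have "{y \<in> ?S. y \<le> \<tau> j} \<subseteq> {i \<in> {1..j - 1}. \<tau> i > j - 1}"
      using that by (auto simp: openers_def)
    then have "the (\<Lambda> j) \<le> card {i \<in> {1..j - 1}. \<tau> i > j - 1}"
      unfolding \<Lambda> by (intro card_mono) auto
    also have "int \<dots> = altitude M (j - 1)" using that by (subst alt) auto
    also have "\<dots> \<le> step_height M j" by (simp add: step_height_def)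
    finally have "int (the (\<Lambda> j)) \<le> step_height M j" by simp
    moreover have "1 \<le> the (\<Lambda> j)"
      using that by (simp add: \<Lambda>_def position_def)
    ultimately show ?thesis by simp
  qed
  moreover have "dom \<Lambda> = down_steps M" by (auto simp: down \<Lambda>_def dom_def)
  ultimately have "labelling M \<Lambda>" by (simp add: labelling_def down)
  with path show ?thesis
    unfolding Phi_eq[OF assms] M_def \<Lambda>_def by (simp add: labelled_motzkin_paths_def)
qed

end

theory Submission
  imports Defs
begin

text \<open>Draw an arc from \<open>i\<close> to \<open>\<tau> i\<close> for every \<open>i < \<tau> i\<close>. Both sides of the equivalence say that
  no arc is nested inside another one. An occurrence of 4321 amounts to a nesting of arcs
  (\<open>contains_4321_iff_nested_arcs\<close>), and the label that \<open>Phi\<close> puts on the closing end of an arc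
  counts, up to the shift by one, the arcs around it (\<open>label_eq_Suc_card_enclosing_arcs\<close>).\<close>

lemma contains_4321_iff:
  "contains_pattern n \<sigma> [4, 3, 2, 1] \<longleftrightarrow>
    (\<exists>a b c d. 1 \<le> a \<and> a < b \<and> b < c \<and> c < d \<and> d \<le> n \<and>
      \<sigma> d < \<sigma> c \<and> \<sigma> c < \<sigma> b \<and> \<sigma> b < \<sigma> a)"
proof
  assume "contains_pattern n \<sigma> [4, 3, 2, 1]"
  then obtain xs where xs: "sorted_wrt (<) xs" "set xs \<subseteq> {1..n}"
      "order_isomorphic (map \<sigma> xs) [4, 3, 2, 1]"
    by (auto simp: contains_pattern_def)
  then have "length xs = Suc (Suc (Suc (Suc 0)))" by (simp add: order_isomorphic_def)
  then obtain a b c d where "xs = [a, b, c, d]" by (auto simp: length_Suc_conv)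
  with xs show "\<exists>a b c d. 1 \<le> a \<and> a < b \<and> b < c \<and> c < d \<and> d \<le> n \<and>
      \<sigma> d < \<sigma> c \<and> \<sigma> c < \<sigma> b \<and> \<sigma> b < \<sigma> a"
    by (intro exI[of _ a] exI[of _ b] exI[of _ c] exI[of _ d])
      (simp add: order_isomorphic_def All_less_Suc numeral_eq_Suc)
next
  assume "\<exists>a b c d. 1 \<le> a \<and> a < b \<and> b < c \<and> c < d \<and> d \<le> n \<and>
      \<sigma> d < \<sigma> c \<and> \<sigma> c < \<sigma> b \<and> \<sigma> b < \<sigma> a"
  then obtain a b c d where "1 \<le> a" "a < b" "b < c" "c < d" "d \<le> n"
      "\<sigma> d < \<sigma> c" "\<sigma> c < \<sigma> b" "\<sigma> b < \<sigma> a" by blast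
  then show "contains_pattern n \<sigma> [4, 3, 2, 1]"
    unfolding contains_pattern_def
    by (intro exI[of _ "[a, b, c, d]"])
      (simp add: order_isomorphic_def All_less_Suc numeral_eq_Suc)
qed

text \<open>The four endpoints of two nested arcs form an occurrence of 4321. Conversely, an occurrence
  at \<open>a < b < c < d\<close> contains a nesting among its first two or its last two entries: if
  \<open>b < \<tau> b\<close>, then \<open>b\<close> opens an arc inside the one opened by \<open>a\<close>; otherwise
  \<open>\<tau> c < \<tau> b \<le> b < c\<close>, so that \<open>c\<close> closes an arc inside the one closed by \<open>d\<close>.\<close>

lemma contains_4321_iff_nested_arcs:
  assumes "\<tau> \<in> involutions n"
  shows "contains_pattern n \<tau> [4, 3, 2, 1] \<longleftrightarrow>
    (\<exists>x\<in>{1..n}. \<exists>y\<in>{1..n}. x < y \<and> y < \<tau> y \<and> \<tau> y < \<tau> x)"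
proof
  note inv = involutionsD[OF assms]
  assume "contains_pattern n \<tau> [4, 3, 2, 1]"
  then obtain a b c d where *: "1 \<le> a" "a < b" "b < c" "c < d" "d \<le> n"
      "\<tau> d < \<tau> c" "\<tau> c < \<tau> b" "\<tau> b < \<tau> a"
    unfolding contains_4321_iff by blast
  show "\<exists>x\<in>{1..n}. \<exists>y\<in>{1..n}. x < y \<and> y < \<tau> y \<and> \<tau> y < \<tau> x"
  proof (cases "b < \<tau> b")
    case True
    with * show ?thesis by (intro bexI[of _ a] bexI[of _ b]) auto
  next
    case False
    with * inv(2)[of c] inv(2)[of d] show ?thesis
      by (intro bexI[of _ "\<tau> d"] bexI[of _ "\<tau> c"]) (auto simp: inv(1))
  qed
next
  note inv = involutionsD[OF assms]
  assume "\<exists>x\<in>{1..n}. \<exists>y\<in>{1..n}. x < y \<and> y < \<tau> y \<and> \<tau> y < \<tau> x"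
  then obtain x y where "x \<in> {1..n}" "x < y" "y < \<tau> y" "\<tau> y < \<tau> x" by blast
  with inv(2)[of x] show "contains_pattern n \<tau> [4, 3, 2, 1]"
    unfolding contains_4321_iff
    by (intro exI[of _ x] exI[of _ y] exI[of _ "\<tau> y"] exI[of _ "\<tau> x"]) (auto simp: inv(1))
qed

lemma down_steps_Phi:
  assumes "\<tau> \<in> involutions n" "Phi n \<tau> = (M, \<Lambda>)"
  shows "down_steps M = {j \<in> {1..n}. \<tau> j < j}"
proof -
  have "labelling M \<Lambda>"
    using Phi_in_labelled_motzkin_paths[OF assms(1)] assms(2)
    by (simp add: labelled_motzkin_paths_def)
  then have "down_steps M = dom \<Lambda>" by (simp add: labelling_def)
  also have "\<dots> = {j \<in> {1..n}. \<tau> j < j}"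
    using assms(2) unfolding Phi_eq[OF assms(1)] by (auto simp: dom_def split: if_splits)
  finally show ?thesis .
qed

text \<open>When step \<open>j\<close> closes the arc from \<open>\<tau> j\<close>, the list searched by \<open>Phi\<close> consists of the starts
  of the arcs that end at \<open>j\<close> or later, in increasing order. The entries in front of \<open>\<tau> j\<close> are
  therefore exactly the starts of the arcs that enclose the arc from \<open>\<tau> j\<close> to \<open>j\<close>.\<close>

lemma label_eq_Suc_card_enclosing_arcs:
  assumes "\<tau> \<in> involutions n" "Phi n \<tau> = (M, \<Lambda>)" "j \<in> {1..n}" "\<tau> j < j"
  shows "\<Lambda> j = Some (Suc (card {x \<in> {1..n}. x < \<tau> j \<and> j < \<tau> x}))"
proof -
  note inv = involutionsD[OF assms(1)]
  let ?S = "openers n \<tau> (j - 1)" and ?E = "{x \<in> {1..n}. x < \<tau> j \<and> j < \<tau> x}"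
  have fin: "finite ?S" by (simp add: openers_def)
  have mem: "\<tau> j \<in> ?S" using assms(3,4) inv(1) inv(2)[of j] by (auto simp: openers_def)
  \<comment> \<open>An arc that starts before \<open>\<tau> j\<close> cannot end at \<open>j\<close>; if still in the list, it ends strictly later.\<close>
  have "\<tau> x \<noteq> j" if "x < \<tau> j" for x using that inv(1)[of x] by auto
  then have "x \<in> ?S \<longleftrightarrow> x \<in> ?E" if "x < \<tau> j" for x
    using that assms(4) by (fastforce simp: openers_def)
  with mem have "{x \<in> ?S. x \<le> \<tau> j} = insert (\<tau> j) ?E"
    by (auto simp: le_less)
  then have "position (\<tau> j) (sorted_list_of_set ?S) = Suc (card ?E)"
    unfolding position_sorted_list_of_set[OF fin mem] by simp
  with assms(2-4) show ?thesis unfolding Phi_eq[OF assms(1)] by auto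
qed

theorem theorem2:
  fixes n :: nat and \<tau> :: "nat \<Rightarrow> nat" and M :: "step list" and \<Lambda> :: "nat \<rightharpoonup> nat"
  assumes "\<tau> \<in> involutions n"
    and "Phi n \<tau> = (M, \<Lambda>)"
  shows "avoids_pattern n \<tau> [4, 3, 2, 1] \<longleftrightarrow> \<Lambda> = unitary_labelling M"
proof -
  note inv = involutionsD[OF assms(1)]
  have down: "down_steps M = {j \<in> {1..n}. \<tau> j < j}" by (rule down_steps_Phi[OF assms])
  have none: "\<Lambda> j = None" if "j \<notin> down_steps M" for j
    using that assms(2) unfolding down Phi_eq[OF assms(1)] by auto
  have "\<Lambda> = unitary_labelling M \<longleftrightarrow> (\<forall>j\<in>down_steps M. \<Lambda> j = Some 1)"
    using none by (auto simp: unitary_labelling_def fun_eq_iff)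
  also have "\<dots> \<longleftrightarrow> (\<forall>j\<in>{1..n}. \<tau> j < j \<longrightarrow> (\<forall>x\<in>{1..n}. \<not> (x < \<tau> j \<and> j < \<tau> x)))"
    using label_eq_Suc_card_enclosing_arcs[OF assms] by (auto simp: down)
  \<comment> \<open>Name the inner arc by its start \<open>y = \<tau> j\<close> instead of its end \<open>j = \<tau> y\<close>.\<close>
  also have "\<dots> \<longleftrightarrow> \<not> (\<exists>x\<in>{1..n}. \<exists>y\<in>{1..n}. x < y \<and> y < \<tau> y \<and> \<tau> y < \<tau> x)"
    using inv(1,2) by metis
  finally show ?thesis
    unfolding avoids_pattern_def contains_4321_iff_nested_arcs[OF assms(1)] by (rule sym)
qed

end
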